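(* Let $r\in\{0,1,2,3\}$, let $\varphi\in K^r(4)$ and $\psi\in K^{r+1}(4)$ be discrete forms vanishing outside $V$. Then $$(d^c\varphi,\ \psi)_V=(\varphi,\ \delta^c\psi)_V,$$ where $$\delta^c\psi=(-1)^{r+1}\ast^{-1}d^c\ast\psi .$$
   Context: Chains. Let $C=C^0\oplus C^1$, where $C^0$ is the real vector space with basis $x_\kappa$ ($\kappa\in\mathbb Z$) and $C^1$ the real vector space with basis $e_\kappa$ ($\kappa\in\mathbb Z$); put $\tau\kappa=\kappa+1$, $\partial x_\kappa=0$, $\partial e_\kappa=x_{\tau\kappa}-x_\kappa$. Let $C(4)=C\otimes C\otimes C\otimes C$, with basis elements $s_k=s_{k_0}\otimes s_{k_1}\otimes s_{k_2}\otimes s_{k_3}$, $k=(k_0,k_1,k_2,k_3)\in\mathbb Z^4$, each $s_{k_i}$ being $x_{k_i}$ or $e_{k_i}$; the dimension of $s_k$ is the number of factors of type $e$. The boundary is extended by $\partial(a\otimes b)=\partial a\otimes b+(-1)^{\dim a}a\otimes\partial b$ and linearity. Cochains (discrete forms). $K(4)=K\otimes K\otimes K\otimes K$ is the dual complex of real cochains, with basis elements $s^k=s^{k_0}\otimes s^{k_1}\otimes s^{k_2}\otimes s^{k_3}$, each $s^{k_i}$ being $x^{k_i}$ or $e^{k_i}$. Forms are (possibly infinite) formal real linear combinations of basis elements; the coefficients are the components $\omega_k^{(r)}$ of the form. The pairing is $\langle \varepsilon_k,s^k\rangle=1$ if $\varepsilon_k=s_k$ is the corresponding basis chain and $0$ otherwise,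 extended linearly. $K^r(4)$ is the space of forms of degree $r$, $K(4)=\bigoplus_{r=0}^4K^r(4)$. The coboundary $d^c:K^r(4)\to K^{r+1}(4)$ is defined by $\langle\partial a,\omega\rangle=\langle a,d^c\omega\rangle$ for all $(r+1)$-chains $a$. Cup product. On $K$: $x^\kappa\cup x^\kappa=x^\kappa$, $e^\kappa\cup x^{\tau\kappa}=e^\kappa$, $x^\kappa\cup e^\kappa=e^\kappa$, and all other products of basis elements are $0$. Inductively, for basis elements $s_{(p)},s_{(q)}$ of the $n$-fold tensor product of $K$ (of degrees $p,q$) and basis elements $s^\kappa,s^\mu$ of $K$, $(s_{(p)}\otimes s^\kappa)\cup(s_{(q)}\otimes s^\mu)=Q(\kappa,q)\,(s_{(p)}\cup s_{(q)})\otimes(s^\kappa\cup s^\mu)$, where $Q(\kappa,q)=-1$ if both $s^\kappa$ and $s_{(q)}$ have odd degree and $Q(\kappa,q)=+1$ otherwise. Extend linearly. Star operator (Lorentz signature). $\ast:K^r(4)\to K^{4-r}(4)$ is the linear bijection sending a basis element $s^k$ to the unique element of the form $\pm$(basis element) with $s^k\cup\ast s^k=Q(k_0)e^k$, where $e^k=e^{k_0}\otimes e^{k_1}\otimes e^{k_2}\otimes e^{k_3}$, $Q(k_0)=+1$ if $s^{k_0}=x^{k_0}$ and $Q(k_0)=-1$ if $s^{k_0}=e^{k_0}$ (so, up to sign, $\ast$ replaces each factor $x^{k_i}$ by $e^{k_i}$ and each factor $e^{k_i}$ by $x^{\tau k_i}$). Domain and inner product. Fix positive integers $N_0,\dots,N_3$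 and let $V=\sum_k e_k$, the sum of $e_k=e_{k_0}\otimes e_{k_1}\otimes e_{k_2}\otimes e_{k_3}$ over $k$ with $1\le k_i\le N_i$, $i=0,1,2,3$. A form vanishes outside $V$ if its components $\omega_k^{(r)}$ are $0$ whenever $k_i<1$ or $k_i>N_i$ for some $i$. For forms of the same degree, $(\varphi,\omega)_V=\langle V,\varphi\cup\ast\omega\rangle$; for forms of different degrees the product is $0$. *)

theory Defs
  imports Complex_Main "HOL-Library.Poly_Mapping"
begin

section \<open>Basis elements\<close>

text \<open>
  A basis element of the complex \<open>C\<close>, and likewise the dual basis element of \<open>K\<close>, is a cell:
  \<open>X k\<close> stands for \<open>x\<^sub>k\<close> (resp. \<open>x\<^sup>k\<close>), \<open>E k\<close> for \<open>e\<^sub>k\<close> (resp. \<open>e\<^sup>k\<close>). Basis elements of tensor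
  powers are pairs nested to the left, so that the inductive rules for \<open>s \<otimes> s\<^sup>\<kappa>\<close>, with \<open>s\<close> in the
  \<open>n\<close>-fold and \<open>s\<^sup>\<kappa>\<close> in the one-fold complex, apply verbatim to a pair \<open>(s, \<kappa>)\<close>.
\<close>

datatype cell = X int | E int

type_synonym cell4 = "((cell \<times> cell) \<times> cell) \<times> cell"

fun idx :: "cell \<Rightarrow> int" where
  "idx (X k) = k"
| "idx (E k) = k"

fun deg1 :: "cell \<Rightarrow> nat" where
  "deg1 (X k) = 0"
| "deg1 (E k) = 1"

definition deg_tensor :: "('a \<Rightarrow> nat) \<Rightarrow> 'a \<times> cell \<Rightarrow> nat" where
  "deg_tensor dg = (\<lambda>(s, \<kappa>). dg s + deg1 \<kappa>)"

definition deg4 :: "cell4 \<Rightarrow> nat" where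
  "deg4 = deg_tensor (deg_tensor (deg_tensor deg1))"

section \<open>Chains\<close>

text \<open>Chains are finite real linear combinations of basis elements.\<close>

type_synonym 'a chain = "'a \<Rightarrow>\<^sub>0 real"

definition scale_chain :: "real \<Rightarrow> 'a chain \<Rightarrow> 'a chain" where
  "scale_chain c a = Poly_Mapping.map ((*) c) a"

definition basis_chain :: "'a \<Rightarrow> 'a chain" where
  "basis_chain s = Poly_Mapping.single s 1"

definition tensor_chain :: "'a chain \<Rightarrow> 'b chain \<Rightarrow> ('a \<times> 'b) chain" where
  "tensor_chain a b = (\<Sum>s \<in> Poly_Mapping.keys a. \<Sum>t \<in> Poly_Mapping.keys b.
     scale_chain (Poly_Mapping.lookup a s * Poly_Mapping.lookup b t) (basis_chain (s, t)))"

fun boundary1 :: "cell \<Rightarrow> cell chain" where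
  "boundary1 (X k) = 0"
| "boundary1 (E k) = basis_chain (X (k + 1)) - basis_chain (X k)"

definition boundary_tensor ::
  "('a \<Rightarrow> 'a chain) \<Rightarrow> ('a \<Rightarrow> nat) \<Rightarrow> 'a \<times> cell \<Rightarrow> ('a \<times> cell) chain" where
  "boundary_tensor bd dg = (\<lambda>(s, \<kappa>).
     tensor_chain (bd s) (basis_chain \<kappa>)
     + scale_chain ((-1) ^ dg s) (tensor_chain (basis_chain s) (boundary1 \<kappa>)))"

definition boundary4 :: "cell4 \<Rightarrow> cell4 chain" where
  "boundary4 =
     boundary_tensor
       (boundary_tensor
         (boundary_tensor boundary1 deg1)
         (deg_tensor deg1))
       (deg_tensor (deg_tensor deg1))"

definition boundary :: "cell4 chain \<Rightarrow> cell4 chain" where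
  "boundary a = (\<Sum>s \<in> Poly_Mapping.keys a. scale_chain (Poly_Mapping.lookup a s) (boundary4 s))"

section \<open>Forms\<close>

text \<open>
  Forms are possibly infinite formal linear combinations of basis elements, that is, arbitrary
  coefficient functions.
\<close>

type_synonym 'a form = "'a \<Rightarrow> real"

definition basis_form :: "'a \<Rightarrow> 'a form" where
  "basis_form s = (\<lambda>t. if t = s then 1 else 0)"

definition scale_form :: "real \<Rightarrow> 'a form \<Rightarrow> 'a form" where
  "scale_form c \<omega> = (\<lambda>s. c * \<omega> s)"

definition forms :: "nat \<Rightarrow> cell4 form set" where
  "forms r = {\<omega>. \<forall>s. \<omega> s \<noteq> 0 \<longrightarrow> deg4 s = r}"

definition pairing :: "'a chain \<Rightarrow> 'a form \<Rightarrow> real" where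
  "pairing a \<omega> = (\<Sum>s \<in> Poly_Mapping.keys a. Poly_Mapping.lookup a s * \<omega> s)"

text \<open>
  The defining identity is imposed on chains and forms of all degrees at once; the boundary being
  homogeneous, on \<open>forms r\<close> this is the same as imposing it for \<open>(r+1)\<close>-chains only.
\<close>

definition coboundary :: "cell4 form \<Rightarrow> cell4 form" where
  "coboundary \<omega> = (THE \<eta>. \<forall>a. pairing (boundary a) \<omega> = pairing a \<eta>)"

section \<open>Cup product\<close>

fun cup1 :: "cell \<Rightarrow> cell \<Rightarrow> cell form" where
  "cup1 (X k) (X l) = (if k = l then basis_form (X k) else (\<lambda>_. 0))"
| "cup1 (E k) (X l) = (if l = k + 1 then basis_form (E k) else (\<lambda>_. 0))"
| "cup1 (X k) (E l) = (if k = l then basis_form (E k) else (\<lambda>_. 0))"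
| "cup1 (E k) (E l) = (\<lambda>_. 0)"

definition tensor_form :: "'a form \<Rightarrow> 'b form \<Rightarrow> ('a \<times> 'b) form" where
  "tensor_form \<alpha> \<beta> = (\<lambda>(s, t). \<alpha> s * \<beta> t)"

definition cup_tensor ::
  "('a \<Rightarrow> 'a \<Rightarrow> 'a form) \<Rightarrow> ('a \<Rightarrow> nat) \<Rightarrow> 'a \<times> cell \<Rightarrow> 'a \<times> cell \<Rightarrow> ('a \<times> cell) form" where
  "cup_tensor cp dg = (\<lambda>(s, \<kappa>) (t, \<mu>).
     scale_form (if odd (deg1 \<kappa>) \<and> odd (dg t) then -1 else 1)
       (tensor_form (cp s t) (cup1 \<kappa> \<mu>)))"

definition cup4 :: "cell4 \<Rightarrow> cell4 \<Rightarrow> cell4 form" where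
  "cup4 =
     cup_tensor
       (cup_tensor
         (cup_tensor cup1 deg1)
         (deg_tensor deg1))
       (deg_tensor (deg_tensor deg1))"

text \<open>
  Bilinear extension to infinite formal sums. Only finitely many pairs \<open>(s, t)\<close> contribute to the
  coefficient at \<open>u\<close>, see \<open>finite_cup4_support\<close> below.
\<close>

definition cup :: "cell4 form \<Rightarrow> cell4 form \<Rightarrow> cell4 form" where
  "cup \<phi> \<psi> = (\<lambda>u. \<Sum>(s, t) \<in> {(s, t). cup4 s t u \<noteq> 0}. \<phi> s * \<psi> t * cup4 s t u)"

section \<open>Star operator\<close>

definition top_cell :: "int \<Rightarrow> int \<Rightarrow> int \<Rightarrow> int \<Rightarrow> cell4" where
  "top_cell k0 k1 k2 k3 = (((E k0, E k1), E k2), E k3)"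

fun top_of :: "cell4 \<Rightarrow> cell4" where
  "top_of (((a, b), c), d) = top_cell (idx a) (idx b) (idx c) (idx d)"

fun lorentz_sign :: "cell4 \<Rightarrow> real" where
  "lorentz_sign (((X k, b), c), d) = 1"
| "lorentz_sign (((E k, b), c), d) = -1"

definition star4 :: "cell4 \<Rightarrow> cell4 form" where
  "star4 s = (THE \<eta>. (\<exists>t. \<eta> = basis_form t \<or> \<eta> = scale_form (-1) (basis_form t)) \<and>
     cup (basis_form s) \<eta> = scale_form (lorentz_sign s) (basis_form (top_of s)))"

text \<open>
  Linear extension to infinite formal sums; exactly one \<open>s\<close> contributes to the coefficient at \<open>u\<close>,
  and the result is bijective, see \<open>star4_support\<close> and \<open>bij_star\<close> below.
\<close>

definition star :: "cell4 form \<Rightarrow> cell4 form" where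
  "star \<omega> = (\<lambda>u. \<Sum>s \<in> {s. star4 s u \<noteq> 0}. \<omega> s * star4 s u)"

text \<open>The codifferential on \<open>forms (r + 1)\<close>, with values in \<open>forms r\<close>.\<close>

definition codiff :: "nat \<Rightarrow> cell4 form \<Rightarrow> cell4 form" where
  "codiff r \<psi> = scale_form ((-1) ^ (r + 1)) (inv star (coboundary (star \<psi>)))"

section \<open>Domain and inner product\<close>

definition domain_chain :: "int \<Rightarrow> int \<Rightarrow> int \<Rightarrow> int \<Rightarrow> cell4 chain" where
  "domain_chain N0 N1 N2 N3 =
     (\<Sum>k0 = 1..N0. \<Sum>k1 = 1..N1. \<Sum>k2 = 1..N2. \<Sum>k3 = 1..N3. basis_chain (top_cell k0 k1 k2 k3))"

definition vanishes_outside :: "int \<Rightarrow> int \<Rightarrow> int \<Rightarrow> int \<Rightarrow> cell4 form \<Rightarrow> bool" where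
  "vanishes_outside N0 N1 N2 N3 \<omega> \<longleftrightarrow>
     (\<forall>a b c d. \<not> (idx a \<in> {1..N0} \<and> idx b \<in> {1..N1} \<and> idx c \<in> {1..N2} \<and> idx d \<in> {1..N3})
        \<longrightarrow> \<omega> (((a, b), c), d) = 0)"

text \<open>
  For homogeneous forms of different degrees the convention that the product is 0 needs no separate
  clause: the cup product then has no component of degree 4, whereas the domain is a 4-chain
  (see \<open>inner_V_diff_deg\<close> below).
\<close>

definition inner_V :: "int \<Rightarrow> int \<Rightarrow> int \<Rightarrow> int \<Rightarrow> cell4 form \<Rightarrow> cell4 form \<Rightarrow> real" where
  "inner_V N0 N1 N2 N3 \<phi> \<omega> = pairing (domain_chain N0 N1 N2 N3) (cup \<phi> (star \<omega>))"

section \<open>Well-definedness\<close>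

declare split_paired_All [simp del] split_paired_Ex [simp del]

lemma lookup_scale_chain [simp]:
  "Poly_Mapping.lookup (scale_chain c a) s = c * Poly_Mapping.lookup a s"
  unfolding scale_chain_def by (simp add: Poly_Mapping.map.rep_eq when_def)

lemma pairing_superset:
  assumes "finite A" "Poly_Mapping.keys a \<subseteq> A"
  shows "pairing a \<omega> = (\<Sum>s\<in>A. Poly_Mapping.lookup a s * \<omega> s)"
  unfolding pairing_def using assms
  by (intro sum.mono_neutral_left) (auto simp: in_keys_iff)

lemma pairing_zero [simp]: "pairing 0 \<omega> = 0"
  by (simp add: pairing_def)

lemma pairing_basis_chain [simp]: "pairing (basis_chain s) \<omega> = \<omega> s"
  by (simp add: pairing_def basis_chain_def)

lemma pairing_add: "pairing (a + b) \<omega> = pairing a \<omega> + pairing b \<omega>"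
proof -
  let ?A = "Poly_Mapping.keys a \<union> Poly_Mapping.keys b"
  have "pairing (a + b) \<omega> = (\<Sum>s\<in>?A. Poly_Mapping.lookup (a + b) s * \<omega> s)"
    by (rule pairing_superset) (auto simp: keys_add)
  moreover have "pairing a \<omega> = (\<Sum>s\<in>?A. Poly_Mapping.lookup a s * \<omega> s)"
    by (rule pairing_superset) auto
  moreover have "pairing b \<omega> = (\<Sum>s\<in>?A. Poly_Mapping.lookup b s * \<omega> s)"
    by (rule pairing_superset) auto
  ultimately show ?thesis
    by (simp add: lookup_add algebra_simps sum.distrib)
qed

lemma pairing_sum: "pairing (sum f A) \<omega> = (\<Sum>x\<in>A. pairing (f x) \<omega>)"
  by (induction A rule: infinite_finite_induct) (auto simp: pairing_add)

lemma pairing_scale_chain: "pairing (scale_chain c a) \<omega> = c * pairing a \<omega>"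
proof -
  have "pairing (scale_chain c a) \<omega>
      = (\<Sum>s\<in>Poly_Mapping.keys a. Poly_Mapping.lookup (scale_chain c a) s * \<omega> s)"
    by (rule pairing_superset) (auto simp: in_keys_iff)
  then show ?thesis
    by (simp add: pairing_def sum_distrib_left algebra_simps)
qed

lemma coboundary_ex1: "\<exists>!\<eta>. \<forall>a. pairing (boundary a) \<omega> = pairing a \<eta>"
proof (rule ex1I)
  show "\<forall>a. pairing (boundary a) \<omega> = pairing a (\<lambda>s. pairing (boundary4 s) \<omega>)"
    by (simp add: boundary_def pairing_sum pairing_scale_chain) (simp add: pairing_def)
next
  fix \<eta> assume *: "\<forall>a. pairing (boundary a) \<omega> = pairing a \<eta>"
  show "\<eta> = (\<lambda>s. pairing (boundary4 s) \<omega>)"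
  proof
    fix s
    have "boundary (basis_chain s) = boundary4 s"
      by (rule poly_mapping_eqI) (simp add: boundary_def basis_chain_def)
    then show "\<eta> s = pairing (boundary4 s) \<omega>"
      using * pairing_basis_chain by metis
  qed
qed

lemma pairing_coboundary: "pairing a (coboundary \<omega>) = pairing (boundary a) \<omega>"
  using theI'[OF coboundary_ex1[of \<omega>], folded coboundary_def] by metis

lemma cup4_apply:
  "cup4 (((a, b), c), d) (((a', b'), c'), d') (((p, q), r), s) =
     (if odd (deg1 b) \<and> odd (deg1 a') then -1 else 1)
     * (if odd (deg1 c) \<and> odd (deg1 a' + deg1 b') then -1 else 1)
     * (if odd (deg1 d) \<and> odd (deg1 a' + deg1 b' + deg1 c') then -1 else 1)
     * (cup1 a a' p * cup1 b b' q * cup1 c c' r * cup1 d d' s)"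
  unfolding cup4_def cup_tensor_def scale_form_def tensor_form_def deg_tensor_def by simp

lemma cup1_support:
  "cup1 a b u \<noteq> 0 \<Longrightarrow> a \<in> {X (idx u), E (idx u)} \<and> b \<in> {X (idx u), X (idx u + 1), E (idx u)}"
  by (cases a; cases b) (auto simp: basis_form_def split: if_splits)

lemma finite_cup4_support: "finite {(s, t). cup4 s t u \<noteq> 0}"
proof -
  obtain p q r w where u: "u = (((p, q), r), w)" by (metis surj_pair)
  define A where "A = (\<lambda>v. {X (idx v), E (idx v)})"
  define B where "B = (\<lambda>v. {X (idx v), X (idx v + 1), E (idx v)})"
  have AB: "cup1 a b v \<noteq> 0 \<Longrightarrow> a \<in> A v \<and> b \<in> B v" for a b v
    unfolding A_def B_def by (rule cup1_support)
  have "{(s, t). cup4 s t u \<noteq> 0}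
      \<subseteq> (((A p \<times> A q) \<times> A r) \<times> A w) \<times> (((B p \<times> B q) \<times> B r) \<times> B w)"
  proof (intro subrelI, unfold mem_Sigma_iff mem_Collect_eq case_prod_conv)
    fix s t assume st: "cup4 s t u \<noteq> 0"
    obtain a b c d where s: "s = (((a, b), c), d)" by (metis surj_pair)
    obtain a' b' c' d' where t: "t = (((a', b'), c'), d')" by (metis surj_pair)
    have nz: "cup4 (((a, b), c), d) (((a', b'), c'), d') u \<noteq> 0"
      using st unfolding s t .
    have "cup1 a a' p \<noteq> 0" "cup1 b b' q \<noteq> 0" "cup1 c c' r \<noteq> 0" "cup1 d d' w \<noteq> 0"
      using nz unfolding u cup4_apply by simp_all
    from this[THEN AB]
    show "s \<in> ((A p \<times> A q) \<times> A r) \<times> A w \<and> t \<in> ((B p \<times> B q) \<times> B r) \<times> B w"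
      unfolding s t by simp
  qed
  then show ?thesis
    by (rule finite_subset) (simp add: A_def B_def)
qed

lemma cup_basis_form: "cup (basis_form s) (basis_form t) = cup4 s t"
proof
  fix u
  have "cup (basis_form s) (basis_form t) u
      = (\<Sum>p \<in> {(s, t). cup4 s t u \<noteq> 0}. if p = (s, t) then cup4 s t u else 0)"
    unfolding cup_def
  proof (intro sum.cong refl)
    fix p :: "cell4 \<times> cell4"
    obtain s' t' where p: "p = (s', t')" by fastforce
    show "(case p of (s', t') \<Rightarrow> basis_form s s' * basis_form t t' * cup4 s' t' u)
        = (if p = (s, t) then cup4 s t u else 0)"
      unfolding p by (simp only: case_prod_conv basis_form_def prod.inject) simp
  qed
  then show "cup (basis_form s) (basis_form t) u = cup4 s t u"
    by (auto simp: finite_cup4_support)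
qed

lemma cup_scale_right: "cup \<phi> (scale_form c \<psi>) = scale_form c (cup \<phi> \<psi>)"
  by (auto simp: cup_def scale_form_def sum_distrib_left case_prod_unfold algebra_simps
      intro!: ext sum.cong)

fun dual_cell1 :: "cell \<Rightarrow> cell" where
  "dual_cell1 (X k) = E k"
| "dual_cell1 (E k) = X (k + 1)"

fun dual_cell4 :: "cell4 \<Rightarrow> cell4" where
  "dual_cell4 (((a, b), c), d) = (((dual_cell1 a, dual_cell1 b), dual_cell1 c), dual_cell1 d)"

lemma cup1_top: "cup1 a b (E (idx a)) = (if b = dual_cell1 a then 1 else 0)"
  by (cases a; cases b) (auto simp: basis_form_def)

lemma cup1_dual: "cup1 a (dual_cell1 a) u = (if u = E (idx a) then 1 else 0)"
  by (cases a) (auto simp: basis_form_def)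

lemma bij_dual_cell4: "bij dual_cell4"
proof -
  define g where "g = (\<lambda>a. case a of E k \<Rightarrow> X k | X k \<Rightarrow> E (k - 1))"
  have g: "g (dual_cell1 a) = a" "dual_cell1 (g a) = a" for a
    by (cases a; simp add: g_def)+
  show ?thesis
    by (rule bij_betw_byWitness[where f' = "\<lambda>(((a, b), c), d). (((g a, g b), g c), g d)"])
       (auto simp: g)
qed

lemma cup4_top_nonzero: "cup4 s t (top_of s) \<noteq> 0 \<Longrightarrow> t = dual_cell4 s"
proof -
  assume nz: "cup4 s t (top_of s) \<noteq> 0"
  obtain a b c d where s: "s = (((a, b), c), d)" by (metis surj_pair)
  obtain a' b' c' d' where t: "t = (((a', b'), c'), d')" by (metis surj_pair)
  have "cup1 a a' (E (idx a)) \<noteq> 0" "cup1 b b' (E (idx b)) \<noteq> 0"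
    "cup1 c c' (E (idx c)) \<noteq> 0" "cup1 d d' (E (idx d)) \<noteq> 0"
    using nz unfolding s t top_of.simps top_cell_def cup4_apply by simp_all
  then show "t = dual_cell4 s"
    by (simp add: s t cup1_top split: if_splits)
qed

lemma cup4_dual:
  "\<exists>\<epsilon>\<in>{1, -1}. cup4 s (dual_cell4 s) = scale_form \<epsilon> (basis_form (top_of s))"
proof -
  obtain a b c d where s: "s = (((a, b), c), d)" by (metis surj_pair)
  define \<epsilon> :: real where "\<epsilon> =
      (if odd (deg1 b) \<and> odd (deg1 (dual_cell1 a)) then -1 else 1)
      * (if odd (deg1 c) \<and> odd (deg1 (dual_cell1 a) + deg1 (dual_cell1 b)) then -1 else 1)
      * (if odd (deg1 d) \<and> odd (deg1 (dual_cell1 a) + deg1 (dual_cell1 b) + deg1 (dual_cell1 c))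
         then -1 else 1)"
  have "cup4 s (dual_cell4 s) = scale_form \<epsilon> (basis_form (top_of s))"
  proof
    fix u :: cell4
    obtain p q r w where u: "u = (((p, q), r), w)" by (metis surj_pair)
    show "cup4 s (dual_cell4 s) u = scale_form \<epsilon> (basis_form (top_of s)) u"
      unfolding s u dual_cell4.simps cup4_apply \<epsilon>_def[symmetric]
      by (simp add: scale_form_def basis_form_def cup1_dual top_cell_def)
  qed
  moreover have "\<epsilon> \<in> {1, -1}"
    unfolding \<epsilon>_def by simp
  ultimately show ?thesis by blast
qed

lemma star4_ex1:
  "\<exists>!\<eta>. (\<exists>t. \<eta> = basis_form t \<or> \<eta> = scale_form (-1) (basis_form t)) \<and>
     cup (basis_form s) \<eta> = scale_form (lorentz_sign s) (basis_form (top_of s))"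
  (is "\<exists>!\<eta>. ?P \<eta>")
proof -
  obtain \<epsilon> where \<epsilon>: "\<epsilon> \<in> {1, -1}"
    "cup4 s (dual_cell4 s) = scale_form \<epsilon> (basis_form (top_of s))"
    using cup4_dual by blast
  have ls: "lorentz_sign s \<in> {1, -1}"
    by (cases s rule: lorentz_sign.cases) auto
  have scale_ss: "scale_form p (scale_form q \<omega>) = scale_form (p * q) \<omega>" for p q and \<omega> :: "cell4 form"
    by (simp add: scale_form_def mult.assoc)
  have scale_1: "scale_form 1 \<omega> = \<omega>" for \<omega> :: "cell4 form"
    by (simp add: scale_form_def)
  have form: "(\<exists>t. \<eta> = basis_form t \<or> \<eta> = scale_form (-1) (basis_form t))
      \<longleftrightarrow> (\<exists>t. \<exists>\<delta>\<in>{1, -1}. \<eta> = scale_form \<delta> (basis_form t))" for \<eta> :: "cell4 form"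
    by (auto simp: scale_1)
  show ?thesis
  proof (rule ex1I)
    show "?P (scale_form (\<epsilon> * lorentz_sign s) (basis_form (dual_cell4 s)))"
    proof
      have "\<epsilon> * lorentz_sign s \<in> {1, -1}" using \<epsilon>(1) ls by auto
      then show "\<exists>t. scale_form (\<epsilon> * lorentz_sign s) (basis_form (dual_cell4 s)) = basis_form t
          \<or> scale_form (\<epsilon> * lorentz_sign s) (basis_form (dual_cell4 s))
            = scale_form (-1) (basis_form t)"
        unfolding form by blast
      have "\<epsilon> * lorentz_sign s * \<epsilon> = lorentz_sign s" using \<epsilon>(1) by auto
      then show "cup (basis_form s) (scale_form (\<epsilon> * lorentz_sign s) (basis_form (dual_cell4 s)))
          = scale_form (lorentz_sign s) (basis_form (top_of s))"
        by (simp only: cup_scale_right cup_basis_form scale_ss \<epsilon>(2))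
    qed
  next
    fix \<eta> assume P: "?P \<eta>"
    then obtain t \<delta> where t: "\<delta> \<in> {1, -1}" "\<eta> = scale_form \<delta> (basis_form t)"
      unfolding form by blast
    have eq: "scale_form \<delta> (cup4 s t) = scale_form (lorentz_sign s) (basis_form (top_of s))"
      using P by (simp add: t cup_scale_right cup_basis_form)
    have "\<delta> * cup4 s t (top_of s) = lorentz_sign s"
      using fun_cong[OF eq, of "top_of s"] by (simp add: scale_form_def basis_form_def)
    with ls have nz: "cup4 s t (top_of s) \<noteq> 0" by auto
    then have td: "t = dual_cell4 s" by (rule cup4_top_nonzero)
    have "\<delta> * \<epsilon> = lorentz_sign s"
      using fun_cong[OF eq, of "top_of s"] by (simp add: td \<epsilon> scale_form_def basis_form_def)
    then have "\<delta> = \<epsilon> * lorentz_sign s" using \<epsilon> by auto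
    then show "\<eta> = scale_form (\<epsilon> * lorentz_sign s) (basis_form (dual_cell4 s))"
      by (simp add: t td)
  qed
qed

lemma star4_spec:
  "cup (basis_form s) (star4 s) = scale_form (lorentz_sign s) (basis_form (top_of s))"
  "\<exists>\<epsilon>\<in>{1, -1}. star4 s = scale_form \<epsilon> (basis_form (dual_cell4 s))"
proof -
  note * = theI'[OF star4_ex1[of s], folded star4_def]
  then show 1: "cup (basis_form s) (star4 s)
      = scale_form (lorentz_sign s) (basis_form (top_of s))" by blast
  from * obtain t \<epsilon> where t: "\<epsilon> \<in> {1, -1}" "star4 s = scale_form \<epsilon> (basis_form t)"
  proof -
    have "scale_form 1 \<omega> = \<omega>" for \<omega> :: "cell4 form"
      by (simp add: scale_form_def)
    with * that show thesis by (metis insertCI)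
  qed
  have "\<epsilon> * cup4 s t (top_of s) = lorentz_sign s"
    using fun_cong[OF 1, of "top_of s"]
    by (simp add: t cup_scale_right cup_basis_form) (simp add: scale_form_def basis_form_def)
  moreover have "lorentz_sign s \<noteq> 0"
    by (cases s rule: lorentz_sign.cases) auto
  ultimately have "t = dual_cell4 s"
    by (intro cup4_top_nonzero) auto
  with t show "\<exists>\<epsilon>\<in>{1, -1}. star4 s = scale_form \<epsilon> (basis_form (dual_cell4 s))" by blast
qed

lemma star4_support: "star4 s u \<noteq> 0 \<longleftrightarrow> s = inv dual_cell4 u"
proof -
  have "star4 s u \<noteq> 0 \<longleftrightarrow> u = dual_cell4 s"
  proof -
    obtain \<epsilon> :: real where "\<epsilon> \<in> {1, -1}" "star4 s = scale_form \<epsilon> (basis_form (dual_cell4 s))"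
      using star4_spec(2) by blast
    then show ?thesis
      by (simp only: scale_form_def basis_form_def) auto
  qed
  also have "\<dots> \<longleftrightarrow> s = inv dual_cell4 u"
    using bij_dual_cell4 by (metis bij_inv_eq_iff)
  finally show ?thesis .
qed

lemma star_apply: "star \<omega> u = \<omega> (inv dual_cell4 u) * star4 (inv dual_cell4 u) u"
  by (simp add: star_def star4_support)

lemma bij_star: "bij star"
proof -
  define c where "c = (\<lambda>u. star4 (inv dual_cell4 u) u)"
  have c: "c u \<noteq> 0" for u by (simp add: c_def star4_support)
  have d: "inv dual_cell4 (dual_cell4 s) = s" "dual_cell4 (inv dual_cell4 s) = s" for s
    using bij_dual_cell4 by (simp_all add: bij_def inv_f_f surj_f_inv_f)
  define g where "g = (\<lambda>\<eta> s. \<eta> (dual_cell4 s) / c (dual_cell4 s))"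
  have st: "star \<omega> u = \<omega> (inv dual_cell4 u) * c u" for \<omega> u
    by (simp only: star_apply c_def)
  have "g (star \<omega>) = \<omega>" for \<omega>
    by (rule ext, unfold g_def st d) (simp add: c)
  moreover have "star (g \<omega>) = \<omega>" for \<omega>
    by (rule ext, unfold g_def st d) (simp add: c)
  ultimately show ?thesis
    by (intro bij_betw_byWitness[where f' = g]) simp_all
qed

lemma cup4_deg: "cup4 s t u \<noteq> 0 \<Longrightarrow> deg4 u = deg4 s + deg4 t"
proof -
  have c1: "cup1 a b p \<noteq> 0 \<Longrightarrow> deg1 p = deg1 a + deg1 b" for a b p
    by (cases a; cases b) (auto simp: basis_form_def split: if_splits)
  assume nz: "cup4 s t u \<noteq> 0"
  obtain a b c d where s: "s = (((a, b), c), d)" by (metis surj_pair)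
  obtain a' b' c' d' where t: "t = (((a', b'), c'), d')" by (metis surj_pair)
  obtain p q v w where u: "u = (((p, q), v), w)" by (metis surj_pair)
  have "cup1 a a' p \<noteq> 0" "cup1 b b' q \<noteq> 0" "cup1 c c' v \<noteq> 0" "cup1 d d' w \<noteq> 0"
    using nz unfolding s t u cup4_apply by simp_all
  from this[THEN c1] show "deg4 u = deg4 s + deg4 t"
    by (simp add: s t u deg4_def deg_tensor_def)
qed

lemma formsD: "\<omega> \<in> forms r \<Longrightarrow> \<omega> s \<noteq> 0 \<Longrightarrow> deg4 s = r"
  unfolding forms_def by blast

lemma star_in_forms:
  assumes "\<omega> \<in> forms r" shows "star \<omega> \<in> forms (4 - r)"
proof -
  have d1: "deg1 (dual_cell1 a) + deg1 a = 1" for a by (cases a) auto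
  have d4: "deg4 (dual_cell4 s) + deg4 s = 4" for s
  proof -
    obtain a b c d where s: "s = (((a, b), c), d)" by (metis surj_pair)
    show ?thesis
      using d1[of a] d1[of b] d1[of c] d1[of d] by (simp add: s deg4_def deg_tensor_def)
  qed
  have "deg4 u = 4 - r" if "star \<omega> u \<noteq> 0" for u
  proof -
    have "\<omega> (inv dual_cell4 u) \<noteq> 0" using that by (simp add: star_apply)
    then have "deg4 (inv dual_cell4 u) = r" by (rule formsD[OF assms])
    then show ?thesis
      using d4[of "inv dual_cell4 u"] bij_dual_cell4 by (simp add: bij_def surj_f_inv_f)
  qed
  then show ?thesis unfolding forms_def by blast
qed

lemma inner_V_diff_deg:
  assumes "\<phi> \<in> forms p" "\<omega> \<in> forms q" "p \<noteq> q" "p \<le> 4" "q \<le> 4"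
  shows "inner_V N0 N1 N2 N3 \<phi> \<omega> = 0"
proof -
  have "cup \<phi> (star \<omega>) (top_cell k0 k1 k2 k3) = 0" for k0 k1 k2 k3
  proof -
    have "\<phi> s * star \<omega> t * cup4 s t (top_cell k0 k1 k2 k3) = 0" for s t
    proof (rule ccontr)
      assume *: "\<phi> s * star \<omega> t * cup4 s t (top_cell k0 k1 k2 k3) \<noteq> 0"
      then have "deg4 s = p" "deg4 t = 4 - q"
        using formsD[OF assms(1)] formsD[OF star_in_forms[OF assms(2)]] by simp_all
      moreover have "deg4 (top_cell k0 k1 k2 k3) = 4"
        by (simp add: top_cell_def deg4_def deg_tensor_def)
      ultimately show False using * assms cup4_deg[of s t "top_cell k0 k1 k2 k3"] by auto
    qed
    then show ?thesis unfolding cup_def by (simp only: case_prod_unfold) simp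
  qed
  then show ?thesis
    by (simp add: inner_V_def domain_chain_def pairing_sum)
qed

end

(* On forms supported in the box V, the inner product is diagonal in the basis elements, with weight
   the Lorentz sign: the shuffle sign produced by the cup product cancels against the one in the star
   operator. Writing both sides with the incidence matrix B of the boundary, the claim reduces to the
   duality B(s', t') = (-1)^(deg t) sgn(s) sgn(t) B(t, s), where s' is the cell underlying the star
   of s and sgn is the shuffle sign. In dimension one this is B(s', t') = -B(t, s); the remaining
   signs are compared factor by factor. No boundary terms appear because both forms vanish
   outside V. *)

theory Submission
  imports Defs
begin

section \<open>Incidence numbers\<close>

definition incidence :: "cell4 \<Rightarrow> cell4 \<Rightarrow> real" where
  "incidence t s = Poly_Mapping.lookup (boundary4 t) s"

lemma lookup_basis_chain: "Poly_Mapping.lookup (basis_chain s) t = (if t = s then 1 else 0)"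
  by (auto simp: basis_chain_def lookup_single when_def)

lemma lookup_tensor_chain:
  "Poly_Mapping.lookup (tensor_chain a b) (s, t) = Poly_Mapping.lookup a s * Poly_Mapping.lookup b t"
proof -
  have inner: "(\<Sum>t'\<in>Poly_Mapping.keys b. Poly_Mapping.lookup a s' * Poly_Mapping.lookup b t'
        * (if (s, t) = (s', t') then 1 else 0))
      = (if s' = s then Poly_Mapping.lookup a s' * Poly_Mapping.lookup b t else 0)" for s'
  proof (cases "s' = s")
    case True
    then have "(\<Sum>t'\<in>Poly_Mapping.keys b. Poly_Mapping.lookup a s' * Poly_Mapping.lookup b t'
        * (if (s, t) = (s', t') then 1 else 0))
      = (\<Sum>t'\<in>Poly_Mapping.keys b.
          if t' = t then Poly_Mapping.lookup a s' * Poly_Mapping.lookup b t else 0)"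
      by (intro sum.cong) auto
    then show ?thesis using True by (auto simp: in_keys_iff)
  qed auto
  show ?thesis
    unfolding tensor_chain_def lookup_sum lookup_scale_chain lookup_basis_chain inner
    by (auto simp: in_keys_iff)
qed

text \<open>Leibniz rule for the left-nested tensor product: each summand changes one factor and
  carries the sign of the total degree of the factors to its left.\<close>

lemma incidence_apply:
  "incidence (((a, b), c), d) (((a', b'), c'), d') =
     Poly_Mapping.lookup (boundary1 a) a' * of_bool (b = b' \<and> c = c' \<and> d = d')
     + (-1) ^ deg1 a * Poly_Mapping.lookup (boundary1 b) b' * of_bool (a = a' \<and> c = c' \<and> d = d')
     + (-1) ^ (deg1 a + deg1 b) * Poly_Mapping.lookup (boundary1 c) c'
       * of_bool (a = a' \<and> b = b' \<and> d = d')
     + (-1) ^ (deg1 a + deg1 b + deg1 c) * Poly_Mapping.lookup (boundary1 d) d'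
       * of_bool (a = a' \<and> b = b' \<and> c = c')"
  unfolding incidence_def boundary4_def boundary_tensor_def deg_tensor_def
  by (simp add: lookup_add lookup_tensor_chain lookup_basis_chain)

text \<open>The shift in \<open>dual_cell1 (E k) = X (k + 1)\<close> exchanges the roles of the two
  endpoints of an edge, which have opposite signs in the boundary.\<close>

lemma lookup_boundary1_dual:
  "Poly_Mapping.lookup (boundary1 (dual_cell1 a)) (dual_cell1 b)
     = - Poly_Mapping.lookup (boundary1 b) a"
  by (cases a; cases b) (auto simp: lookup_minus lookup_basis_chain)

lemma lookup_boundary1_nonzero:
  "Poly_Mapping.lookup (boundary1 a) b \<noteq> 0 \<Longrightarrow> \<exists>k l. a = E k \<and> b = X l"
  by (cases a; cases b) (auto simp: lookup_minus lookup_basis_chain)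

lemma dual_cell1_eq_iff: "dual_cell1 a = dual_cell1 b \<longleftrightarrow> a = b"
  by (cases a; cases b) auto

text \<open>The part of the star sign that does not depend on the signature: the star of
  \<open>s\<close> is the dual cell times this and the Lorentz sign.\<close>

definition shuffle_sign :: "cell4 \<Rightarrow> real" where
  "shuffle_sign s = cup4 s (dual_cell4 s) (top_of s)"

lemma shuffle_sign_apply:
  "shuffle_sign (((a, b), c), d) =
     (-1) ^ (deg1 b * deg1 (dual_cell1 a))
     * (-1) ^ (deg1 c * (deg1 (dual_cell1 a) + deg1 (dual_cell1 b)))
     * (-1) ^ (deg1 d * (deg1 (dual_cell1 a) + deg1 (dual_cell1 b) + deg1 (dual_cell1 c)))"
  unfolding shuffle_sign_def dual_cell4.simps top_of.simps top_cell_def cup4_apply cup1_top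
  by (simp add: minus_one_power_iff)

lemma shuffle_sign_square: "shuffle_sign s * shuffle_sign s = 1"
proof -
  obtain a b c d where "s = (((a, b), c), d)" by (metis surj_pair)
  then show ?thesis by (cases a; cases b; cases c; cases d) (simp_all add: shuffle_sign_apply)
qed

lemma shuffle_sign_nonzero: "shuffle_sign s \<noteq> 0"
  using shuffle_sign_square[of s] by auto

text \<open>Up to signs, passing to dual cells transposes the incidence matrix. Both sides split
  into four summands, one per factor in which the cells may differ; the one-dimensional duality
  handles that factor, and a comparison of signs is left.\<close>

lemma incidence_dual:
  "incidence (dual_cell4 s) (dual_cell4 t)
     = (-1) ^ deg4 t * shuffle_sign s * shuffle_sign t * incidence t s"
proof -
  obtain a b c d where s: "s = (((a, b), c), d)" by (metis surj_pair)
  obtain a' b' c' d' where t: "t = (((a', b'), c'), d')" by (metis surj_pair)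
  define \<sigma> where "\<sigma> = (-1) ^ deg4 t * shuffle_sign s * shuffle_sign t"
  let ?D = "\<lambda>x y. Poly_Mapping.lookup (boundary1 x) y"
  note sign_simps = deg4_def deg_tensor_def shuffle_sign_apply
  \<comment> \<open>A nonzero summand forces the varying factor to be an \<open>E\<close> in
    \<open>t\<close> and an \<open>X\<close> in \<open>s\<close> and the other three to agree, so
    eight sign checks remain. The next three equations follow the same pattern.\<close>
  have 1: "- ?D a' a * of_bool (b = b' \<and> c = c' \<and> d = d')
      = \<sigma> * (?D a' a * of_bool (b' = b \<and> c' = c \<and> d' = d))"
  proof (cases "?D a' a \<noteq> 0 \<and> b = b' \<and> c = c' \<and> d = d'")
    case True
    then obtain k l where "a' = E k" "a = X l"
      using lookup_boundary1_nonzero by blast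
    moreover have "b' = b" "c' = c" "d' = d" using True by simp_all
    ultimately show ?thesis
      unfolding \<sigma>_def s t
      by (cases b; cases c; cases d) (simp_all add: sign_simps)
  qed auto
  have 2: "(-1) ^ deg1 (dual_cell1 a) * - ?D b' b * of_bool (a = a' \<and> c = c' \<and> d = d')
      = \<sigma> * ((-1) ^ deg1 a' * ?D b' b * of_bool (a' = a \<and> c' = c \<and> d' = d))"
  proof (cases "?D b' b \<noteq> 0 \<and> a = a' \<and> c = c' \<and> d = d'")
    case True
    then obtain k l where "b' = E k" "b = X l"
      using lookup_boundary1_nonzero by blast
    moreover have "a' = a" "c' = c" "d' = d" using True by simp_all
    ultimately show ?thesis
      unfolding \<sigma>_def s t
      by (cases a; cases c; cases d) (simp_all add: sign_simps)
  qed auto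
  have 3: "(-1) ^ (deg1 (dual_cell1 a) + deg1 (dual_cell1 b)) * - ?D c' c
        * of_bool (a = a' \<and> b = b' \<and> d = d')
      = \<sigma> * ((-1) ^ (deg1 a' + deg1 b') * ?D c' c * of_bool (a' = a \<and> b' = b \<and> d' = d))"
  proof (cases "?D c' c \<noteq> 0 \<and> a = a' \<and> b = b' \<and> d = d'")
    case True
    then obtain k l where "c' = E k" "c = X l"
      using lookup_boundary1_nonzero by blast
    moreover have "a' = a" "b' = b" "d' = d" using True by simp_all
    ultimately show ?thesis
      unfolding \<sigma>_def s t
      by (cases a; cases b; cases d) (simp_all add: sign_simps)
  qed auto
  have 4: "(-1) ^ (deg1 (dual_cell1 a) + deg1 (dual_cell1 b) + deg1 (dual_cell1 c)) * - ?D d' d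
        * of_bool (a = a' \<and> b = b' \<and> c = c')
      = \<sigma> * ((-1) ^ (deg1 a' + deg1 b' + deg1 c') * ?D d' d * of_bool (a' = a \<and> b' = b \<and> c' = c))"
  proof (cases "?D d' d \<noteq> 0 \<and> a = a' \<and> b = b' \<and> c = c'")
    case True
    then obtain k l where "d' = E k" "d = X l"
      using lookup_boundary1_nonzero by blast
    moreover have "a' = a" "b' = b" "c' = c" using True by simp_all
    ultimately show ?thesis
      unfolding \<sigma>_def s t
      by (cases a; cases b; cases c) (simp_all add: sign_simps)
  qed auto
  have "incidence (dual_cell4 s) (dual_cell4 t) = \<sigma> * incidence t s"
    unfolding s t dual_cell4.simps incidence_apply lookup_boundary1_dual dual_cell1_eq_iff
      distrib_left 1 2 3 4 ..
  then show ?thesis unfolding \<sigma>_def .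
qed

section \<open>Coboundary and star in coordinates\<close>

text \<open>Finiteness is taken from the form instead of the chain, so the index set does not vary
  with the chain and sums can later be exchanged.\<close>

lemma pairing_supported:
  assumes "finite A" "\<And>s. s \<notin> A \<Longrightarrow> \<omega> s = 0"
  shows "pairing a \<omega> = (\<Sum>s\<in>A. Poly_Mapping.lookup a s * \<omega> s)"
proof -
  have "pairing a \<omega> = (\<Sum>s\<in>A \<union> Poly_Mapping.keys a. Poly_Mapping.lookup a s * \<omega> s)"
    using assms(1) by (intro pairing_superset) auto
  also have "\<dots> = (\<Sum>s\<in>A. Poly_Mapping.lookup a s * \<omega> s)"
    using assms by (intro sum.mono_neutral_right) auto
  finally show ?thesis .
qed

text \<open>Testing the defining identity on the basis chain of \<open>t\<close> shows that the
  coboundary acts by the incidence matrix.\<close>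

lemma coboundary_supported:
  assumes "finite A" "\<And>s. s \<notin> A \<Longrightarrow> \<omega> s = 0"
  shows "coboundary \<omega> t = (\<Sum>s\<in>A. incidence t s * \<omega> s)"
proof -
  have "boundary (basis_chain t) = boundary4 t"
    by (rule poly_mapping_eqI) (simp add: boundary_def basis_chain_def)
  then have "coboundary \<omega> t = pairing (boundary4 t) \<omega>"
    using pairing_coboundary[of "basis_chain t" \<omega>] by simp
  then show ?thesis
    using pairing_supported[OF assms] by (simp add: incidence_def)
qed

lemma lorentz_sign_square: "lorentz_sign s * lorentz_sign s = 1"
  by (cases s rule: lorentz_sign.cases) auto

lemma inv_dual_cell4 [simp]: "inv dual_cell4 (dual_cell4 s) = s"
  using bij_dual_cell4 by (simp add: bij_def inv_f_f)

text \<open>The shape of \<open>star4 s\<close> leaves a sign open; the coefficient at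
  \<open>top_of s\<close> in its defining equation determines it, since
  \<open>shuffle_sign s\<close> is its own inverse.\<close>

lemma star_dual:
  "star \<omega> (dual_cell4 s) = lorentz_sign s * shuffle_sign s * \<omega> s"
proof -
  obtain \<epsilon> where \<epsilon>: "\<epsilon> \<in> {1, -1}" "star4 s = scale_form \<epsilon> (basis_form (dual_cell4 s))"
    using star4_spec(2) by blast
  have "cup (basis_form s) (star4 s) (top_of s) = \<epsilon> * shuffle_sign s"
    by (simp add: \<epsilon>(2) cup_scale_right cup_basis_form)
      (simp add: scale_form_def shuffle_sign_def)
  then have "\<epsilon> * shuffle_sign s = lorentz_sign s"
    by (simp add: star4_spec(1)) (simp add: scale_form_def basis_form_def)
  moreover have "star4 s (dual_cell4 s) = \<epsilon>"
    by (simp add: \<epsilon>(2) scale_form_def basis_form_def)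
  ultimately have "star4 s (dual_cell4 s) = lorentz_sign s * shuffle_sign s"
    using shuffle_sign_square[of s] by (metis mult.assoc mult.right_neutral)
  then show ?thesis by (simp add: star_apply)
qed

lemma inv_star_apply:
  "inv star \<eta> s = \<eta> (dual_cell4 s) / (lorentz_sign s * shuffle_sign s)"
proof -
  have "lorentz_sign s \<noteq> 0" using lorentz_sign_square[of s] by auto
  moreover have "star (inv star \<eta>) = \<eta>"
    using bij_star by (simp add: bij_def surj_f_inv_f)
  then have "lorentz_sign s * shuffle_sign s * inv star \<eta> s = \<eta> (dual_cell4 s)"
    using star_dual[of "inv star \<eta>" s] by simp
  ultimately show ?thesis
    using shuffle_sign_nonzero[of s] by (simp add: field_simps)
qed

text \<open>The codifferential is the transposed incidence matrix, conjugated by Lorentz signs. By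
  \<open>incidence_dual\<close> the shuffle signs cancel, and the sign from the degree of
  \<open>t\<close> cancels the prefactor \<open>(-1) ^ (r + 1)\<close>.\<close>

lemma codiff_supported:
  assumes "finite A" "\<And>s. s \<notin> A \<Longrightarrow> \<psi> s = 0"
    and "\<psi> \<in> forms (r + 1)"
  shows "lorentz_sign s * codiff r \<psi> s = (\<Sum>t\<in>A. lorentz_sign t * incidence t s * \<psi> t)"
proof -
  \<comment> \<open>The support moves to the dual cells. These can leave a box, since
    \<open>E k\<close> becomes \<open>X (k + 1)\<close>, so the sum has to run over the image of
    \<open>A\<close>.\<close>
  have out: "star \<psi> u = 0" if "u \<notin> dual_cell4 ` A" for u
  proof -
    have "u = dual_cell4 (inv dual_cell4 u)"
      using bij_dual_cell4 by (simp add: bij_def surj_f_inv_f)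
    then have "inv dual_cell4 u \<notin> A" using that by blast
    then show ?thesis using assms(2) by (simp add: star_apply)
  qed
  have "coboundary (star \<psi>) (dual_cell4 s)
      = (\<Sum>u\<in>dual_cell4 ` A. incidence (dual_cell4 s) u * star \<psi> u)"
    using assms(1) out by (intro coboundary_supported) auto
  also have "\<dots> = (\<Sum>t\<in>A. incidence (dual_cell4 s) (dual_cell4 t) * star \<psi> (dual_cell4 t))"
    using bij_dual_cell4 by (subst sum.reindex) (auto simp: bij_def intro: inj_on_subset)
  also have "\<dots> = (\<Sum>t\<in>A. (-1) ^ (r + 1) * shuffle_sign s
      * (lorentz_sign t * incidence t s * \<psi> t))"
  proof (intro sum.cong refl)
    fix t assume "t \<in> A"
    show "incidence (dual_cell4 s) (dual_cell4 t) * star \<psi> (dual_cell4 t)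
        = (-1) ^ (r + 1) * shuffle_sign s * (lorentz_sign t * incidence t s * \<psi> t)"
    \<comment> \<open>The degree of \<open>t\<close> is known only where \<open>\<psi> t\<close> is
      nonzero; homogeneity of \<open>\<psi>\<close> makes the sign uniform in
      \<open>t\<close>.\<close>
    proof (cases "\<psi> t = 0")
      case False
      then have "deg4 t = r + 1" by (rule formsD[OF assms(3)])
      then have "incidence (dual_cell4 s) (dual_cell4 t) * star \<psi> (dual_cell4 t)
        = (shuffle_sign t * shuffle_sign t)
          * ((-1) ^ (r + 1) * shuffle_sign s * (lorentz_sign t * incidence t s * \<psi> t))"
        unfolding incidence_dual star_dual by (simp only: mult_ac)
      then show ?thesis by (simp only: shuffle_sign_square mult_1_left)
    qed (simp add: star_dual)
  qed
  finally have cob: "coboundary (star \<psi>) (dual_cell4 s)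
      = (-1) ^ (r + 1) * shuffle_sign s * (\<Sum>t\<in>A. lorentz_sign t * incidence t s * \<psi> t)"
    by (simp only: sum_distrib_left)
  have "(-1 :: real) ^ (r + 1) * (-1) ^ (r + 1) = 1"
    by (simp flip: power_add power_mult_distrib)
  moreover have "lorentz_sign s \<noteq> 0" using lorentz_sign_square[of s] by auto
  ultimately show ?thesis
    unfolding codiff_def scale_form_def inv_star_apply cob
    using shuffle_sign_nonzero[of s] by (simp add: field_simps)
qed

section \<open>The inner product in coordinates\<close>

definition box_cells :: "int \<Rightarrow> int \<Rightarrow> int \<Rightarrow> int \<Rightarrow> cell4 set" where
  "box_cells N0 N1 N2 N3 =
     (((idx -` {1..N0}) \<times> (idx -` {1..N1})) \<times> (idx -` {1..N2})) \<times> (idx -` {1..N3})"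

lemma finite_vimage_idx: "finite A \<Longrightarrow> finite (idx -` A)"
proof (rule finite_subset)
  show "idx -` A \<subseteq> X ` A \<union> E ` A"
  proof
    fix c assume "c \<in> idx -` A"
    then show "c \<in> X ` A \<union> E ` A" by (cases c) auto
  qed
qed simp

lemma finite_box_cells: "finite (box_cells N0 N1 N2 N3)"
  unfolding box_cells_def by (intro finite_cartesian_product finite_vimage_idx) simp_all

lemma vanishes_outside_box_cells:
  assumes "vanishes_outside N0 N1 N2 N3 \<omega>" "s \<notin> box_cells N0 N1 N2 N3"
  shows "\<omega> s = 0"
proof -
  obtain a b c d where "s = (((a, b), c), d)" by (metis surj_pair)
  with assms show ?thesis unfolding vanishes_outside_def box_cells_def by auto
qed

lemma cup1_idx: "cup1 a b u \<noteq> 0 \<Longrightarrow> idx a = idx u"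
  by (drule cup1_support) auto

text \<open>In each factor the left cell keeps the index of the product, and the right cell must be
  its dual. This collapses the double sum in \<open>cup\<close> to a single one.\<close>

lemma cup4_top_cell_support:
  "{(s, t). cup4 s t (top_cell k0 k1 k2 k3) \<noteq> 0}
     = (\<lambda>s. (s, dual_cell4 s)) ` {s. top_of s = top_cell k0 k1 k2 k3}" (is "?L = ?R")
proof
  show "?L \<subseteq> ?R"
  proof
    fix p assume "p \<in> ?L"
    then obtain s t where p: "p = (s, t)" and nz: "cup4 s t (top_cell k0 k1 k2 k3) \<noteq> 0" by blast
    obtain a b c d where s: "s = (((a, b), c), d)" by (metis surj_pair)
    obtain a' b' c' d' where t: "t = (((a', b'), c'), d')" by (metis surj_pair)
    have "cup1 a a' (E k0) \<noteq> 0" "cup1 b b' (E k1) \<noteq> 0"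
      "cup1 c c' (E k2) \<noteq> 0" "cup1 d d' (E k3) \<noteq> 0"
      using nz unfolding s t top_cell_def cup4_apply by simp_all
    from this[THEN cup1_idx] have top: "top_of s = top_cell k0 k1 k2 k3"
      by (simp add: s)
    then have "t = dual_cell4 s" using nz cup4_top_nonzero by simp
    then show "p \<in> ?R" using top p by blast
  qed
  show "?R \<subseteq> ?L"
  proof
    fix p assume "p \<in> ?R"
    then obtain s where "p = (s, dual_cell4 s)" "top_of s = top_cell k0 k1 k2 k3" by blast
    then show "p \<in> ?L" using shuffle_sign_nonzero[of s] by (simp add: shuffle_sign_def)
  qed
qed

text \<open>The shuffle sign occurs once in the cup product and once in the star, so only the
  Lorentz sign survives.\<close>

lemma cup_star_top_cell:
  "cup \<phi> (star \<omega>) (top_cell k0 k1 k2 k3)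
     = (\<Sum>s | top_of s = top_cell k0 k1 k2 k3. lorentz_sign s * \<phi> s * \<omega> s)"
proof -
  have "cup \<phi> (star \<omega>) (top_cell k0 k1 k2 k3)
      = (\<Sum>s | top_of s = top_cell k0 k1 k2 k3.
          \<phi> s * star \<omega> (dual_cell4 s) * cup4 s (dual_cell4 s) (top_cell k0 k1 k2 k3))"
    unfolding cup_def cup4_top_cell_support
    by (subst sum.reindex) (auto intro: inj_onI)
  also have "\<dots> = (\<Sum>s | top_of s = top_cell k0 k1 k2 k3. lorentz_sign s * \<phi> s * \<omega> s)"
  proof (intro sum.cong refl)
    fix s assume "s \<in> {s. top_of s = top_cell k0 k1 k2 k3}"
    then have "cup4 s (dual_cell4 s) (top_cell k0 k1 k2 k3) = shuffle_sign s"
      by (simp add: shuffle_sign_def)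
    then show "\<phi> s * star \<omega> (dual_cell4 s) * cup4 s (dual_cell4 s) (top_cell k0 k1 k2 k3)
        = lorentz_sign s * \<phi> s * \<omega> s"
      using shuffle_sign_square[of s] by (simp add: star_dual mult_ac)
  qed
  finally show ?thesis .
qed

text \<open>The cells of the box are grouped by multi-index. The formula covers arbitrary forms,
  hence also \<open>coboundary \<phi>\<close> and \<open>codiff r \<psi>\<close>, which may be
  nonzero outside the box.\<close>

lemma inner_V_eq_sum:
  "inner_V N0 N1 N2 N3 \<phi> \<omega> = (\<Sum>s\<in>box_cells N0 N1 N2 N3. lorentz_sign s * \<phi> s * \<omega> s)"
proof -
  define g where "g = (\<lambda>(((a, b), c), d). (idx a, idx b, idx c, idx d))"
  define K where "K = {1..N0} \<times> {1..N1} \<times> {1..N2} \<times> {1..N3}"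
  define f where "f = (\<lambda>s. lorentz_sign s * \<phi> s * \<omega> s)"
  have fibre: "{s. top_of s = top_cell k0 k1 k2 k3}
      = {s \<in> box_cells N0 N1 N2 N3. g s = (k0, k1, k2, k3)}" if "(k0, k1, k2, k3) \<in> K"
    for k0 k1 k2 k3
    using that by (auto simp: box_cells_def g_def K_def top_cell_def)
  have "inner_V N0 N1 N2 N3 \<phi> \<omega> = (\<Sum>k0 = 1..N0. \<Sum>k1 = 1..N1. \<Sum>k2 = 1..N2. \<Sum>k3 = 1..N3.
      sum f {s. top_of s = top_cell k0 k1 k2 k3})"
    by (simp add: inner_V_def domain_chain_def pairing_sum cup_star_top_cell f_def)
  also have "\<dots> = (\<Sum>k\<in>K. case k of (k0, k1, k2, k3) \<Rightarrow>
      sum f {s. top_of s = top_cell k0 k1 k2 k3})"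
    unfolding K_def by (simp add: sum.cartesian_product)
  also have "\<dots> = (\<Sum>k\<in>K. sum f {s \<in> box_cells N0 N1 N2 N3. g s = k})"
    by (intro sum.cong refl) (auto simp: fibre)
  also have "\<dots> = sum f (box_cells N0 N1 N2 N3)"
    by (rule sum.group[OF finite_box_cells]) (auto simp: K_def g_def box_cells_def)
  finally show ?thesis unfolding f_def .
qed

theorem proposition3p2:
  fixes N0 N1 N2 N3 :: int and r :: nat and \<phi> \<psi> :: "cell4 form"
  assumes "N0 > 0" "N1 > 0" "N2 > 0" "N3 > 0"
    and "r \<in> {0, 1, 2, 3}"
    and "\<phi> \<in> forms r" and "\<psi> \<in> forms (r + 1)"
    and "vanishes_outside N0 N1 N2 N3 \<phi>" and "vanishes_outside N0 N1 N2 N3 \<psi>"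
  shows "inner_V N0 N1 N2 N3 (coboundary \<phi>) \<psi> = inner_V N0 N1 N2 N3 \<phi> (codiff r \<psi>)"
proof -
  let ?B = "box_cells N0 N1 N2 N3"
  \<comment> \<open>Cells outside the box contribute nothing to either expansion, so both use the
    same index set and no boundary terms arise.\<close>
  have \<phi>: "coboundary \<phi> t = (\<Sum>s\<in>?B. incidence t s * \<phi> s)" for t
    using finite_box_cells vanishes_outside_box_cells[OF assms(8)] by (rule coboundary_supported)
  have \<psi>: "lorentz_sign s * codiff r \<psi> s = (\<Sum>t\<in>?B. lorentz_sign t * incidence t s * \<psi> t)" for s
    using finite_box_cells vanishes_outside_box_cells[OF assms(9)] assms(7)
    by (rule codiff_supported)
  \<comment> \<open>Both inner products are the same finite double sum, taken in opposite
    orders.\<close>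
  have "inner_V N0 N1 N2 N3 (coboundary \<phi>) \<psi>
      = (\<Sum>t\<in>?B. \<Sum>s\<in>?B. \<phi> s * (lorentz_sign t * incidence t s * \<psi> t))"
    unfolding inner_V_eq_sum \<phi> by (simp add: sum_distrib_left sum_distrib_right mult_ac)
  also have "\<dots> = (\<Sum>s\<in>?B. \<phi> s * (lorentz_sign s * codiff r \<psi> s))"
    unfolding \<psi> sum_distrib_left by (rule sum.swap)
  also have "\<dots> = inner_V N0 N1 N2 N3 \<phi> (codiff r \<psi>)"
    unfolding inner_V_eq_sum by (simp add: mult_ac)
  finally show ?thesis .
qed

end
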